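(* Let $T\in\mathcal T_n$ and $U\in\mathcal T_m$. Then $T\preceq U$ if and only if there is an $n$-element set $R=\{r_1<\cdots<r_n\}\subseteq[m]$ such that $$\Sigma(T)\subseteq\Sigma_R(U).$$
   Context: $[m]=\{1,\dots,m\}$, and $\mathcal T_m$ is the set of trees with vertex set $[m]$ (labeled trees). Displays and containment. Let $T\in\mathcal T_n$, $U\in\mathcal T_m$. A display of $T$ in $U$ is a pair $(R,q)$ where $R=\{r_1<\cdots<r_n\}\subseteq[m]$ is an $n$-element set and $q:[m]\to R$ is a retraction ($q(r)=r$ for $r\in R$) such that (1) every fiber $q^{-1}(r_i)$ induces a connected subtree of $U$; (2) after each fiber is contracted to one vertex, the quotient tree, with the vertex coming from $q^{-1}(r_i)$ labeled $i$, is equal to $T$. Write $T\preceq U$ when $U$ admits at least one display of $T$. Edge splits. For an edge $e$ of $T\in\mathcal T_n$, deleting $e$ leaves two components with label sets $A_e$ and $A_e^c=[n]\setminus A_e$; the unordered bipartition $A_e\mid A_e^c$ is the edge split of $e$, and $\Sigma(T)=\{A_e\mid A_e^c: e\in E(T)\}$. Survivor splits. Let $U\in\mathcal T_m$ and $R=\{r_1<\cdots<r_n\}\subseteq[m]$. For an edge $g$ of $U$, let $I_g\subseteq[n]$ be the set of indices $i$ such that $r_i$ lies in one (chosen) component of $U-g$, and $I_g^c=[n]\setminus I_g$. Then $\Sigma_R(U)$ is the set of unordered bipartitions $\{I_g\mid I_g^c: g\in E(U),\ I_g\neq\varnothing,\ I_g^c\neq\varnothing\}$ (a set, so repetitions are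 recorded once). *)

theory Defs
  imports Main "HOL-Library.FuncSet"
begin

text \<open>A finite simple graph is given by its vertex set \<open>V\<close> and its set \<open>E\<close> of edges, each a
  two-element subset of \<open>V\<close>. A labeled tree is identified with its edge set, the vertex set
  being \<open>{1..n}\<close>.\<close>

definition adj :: "'a set set \<Rightarrow> ('a \<times> 'a) set" where
  "adj E = {(u, v). {u, v} \<in> E}"

definition simple_graph :: "'a set \<Rightarrow> 'a set set \<Rightarrow> bool" where
  "simple_graph V E \<longleftrightarrow> finite V \<and> (\<forall>e\<in>E. e \<subseteq> V \<and> card e = 2)"

definition connected_graph :: "'a set \<Rightarrow> 'a set set \<Rightarrow> bool" where
  "connected_graph V E \<longleftrightarrow> V \<noteq> {} \<and> (\<forall>u\<in>V. \<forall>v\<in>V. (u, v) \<in> (adj E)\<^sup>*)"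

definition is_cycle :: "'a set set \<Rightarrow> 'a list \<Rightarrow> bool" where
  "is_cycle E vs \<longleftrightarrow> 3 \<le> length vs \<and> distinct vs \<and>
     (\<forall>i<length vs. {vs ! i, vs ! (Suc i mod length vs)} \<in> E)"

definition is_tree :: "'a set \<Rightarrow> 'a set set \<Rightarrow> bool" where
  "is_tree V E \<longleftrightarrow> simple_graph V E \<and> connected_graph V E \<and> (\<nexists>vs. is_cycle E vs)"

definition labeled_trees :: "nat \<Rightarrow> nat set set set" where
  "labeled_trees m = {E. is_tree {1..m} E}"

definition induced_edges :: "'a set set \<Rightarrow> 'a set \<Rightarrow> 'a set set" where
  "induced_edges E S = {e \<in> E. e \<subseteq> S}"

definition components :: "'a set \<Rightarrow> 'a set set \<Rightarrow> 'a set set" where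
  "components V E = V // (adj E)\<^sup>*"

text \<open>\<open>nth_elem R i\<close> is \<open>r\<^sub>i\<close> when \<open>R = {r\<^sub>1 < \<dots> < r\<^sub>n}\<close> and \<open>1 \<le> i \<le> n\<close>
  (counting from 1).\<close>

definition nth_elem :: "nat set \<Rightarrow> nat \<Rightarrow> nat" where
  "nth_elem R i = sorted_list_of_set R ! (i - 1)"

definition fiber :: "nat \<Rightarrow> (nat \<Rightarrow> nat) \<Rightarrow> nat \<Rightarrow> nat set" where
  "fiber m q r = {v \<in> {1..m}. q v = r}"

text \<open>Edges of the graph obtained from \<open>U\<close> by contracting every fiber of \<open>q\<close>, the vertex coming
  from the fiber over \<open>r\<^sub>i\<close> being labeled \<open>i\<close>.\<close>

definition quotient_edges ::
  "nat \<Rightarrow> nat \<Rightarrow> nat set set \<Rightarrow> nat set \<Rightarrow> (nat \<Rightarrow> nat) \<Rightarrow> nat set set" where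
  "quotient_edges n m U R q =
     {{i, j} | i j. i \<in> {1..n} \<and> j \<in> {1..n} \<and> i \<noteq> j \<and>
        (\<exists>u\<in>fiber m q (nth_elem R i). \<exists>v\<in>fiber m q (nth_elem R j). {u, v} \<in> U)}"

definition is_display ::
  "nat \<Rightarrow> nat set set \<Rightarrow> nat \<Rightarrow> nat set set \<Rightarrow> nat set \<times> (nat \<Rightarrow> nat) \<Rightarrow> bool" where
  "is_display n T m U = (\<lambda>(R, q).
     R \<subseteq> {1..m} \<and> card R = n \<and>
     q \<in> {1..m} \<rightarrow>\<^sub>E R \<and> (\<forall>r\<in>R. q r = r) \<and>
     (\<forall>i\<in>{1..n}. is_tree (fiber m q (nth_elem R i))
                     (induced_edges U (fiber m q (nth_elem R i)))) \<and>
     quotient_edges n m U R q = T)"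

definition displayed_in :: "nat \<Rightarrow> nat set set \<Rightarrow> nat \<Rightarrow> nat set set \<Rightarrow> bool" where
  "displayed_in n T m U \<longleftrightarrow> (\<exists>d. is_display n T m U d)"

text \<open>An unordered bipartition \<open>A | A\<^sup>c\<close> of \<open>{1..n}\<close> is the set \<open>{A, {1..n} - A}\<close>; it does not
  depend on which of the two components of the tree minus an edge is chosen below.\<close>

definition edge_splits :: "nat \<Rightarrow> nat set set \<Rightarrow> nat set set set" where
  "edge_splits n T =
     {{A, {1..n} - A} | A e. e \<in> T \<and> A \<in> components {1..n} (T - {e})}"

definition survivor_splits ::
  "nat \<Rightarrow> nat \<Rightarrow> nat set set \<Rightarrow> nat set \<Rightarrow> nat set set set" where
  "survivor_splits n m U R =
     {{I, {1..n} - I} | I g C. g \<in> U \<and> C \<in> components {1..m} (U - {g}) \<and>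
        I = {i \<in> {1..n}. nth_elem R i \<in> C} \<and> I \<noteq> {} \<and> {1..n} - I \<noteq> {}}"

end

theory Submission imports Defs begin

text \<open>Two vertices lie on the same side of an edge of a tree iff they are linked by a path once that
  edge is removed. Since the removal leaves exactly two sides, a bipartition is determined by the
  relation ``on the same side'', and \<open>\<Sigma>(T) \<subseteq> \<Sigma>\<^sub>R(U)\<close> says that each edge \<open>e\<close> of \<open>T\<close> has a
  partner \<open>g\<close> in \<open>U\<close> that separates \<open>r\<^sub>i\<close> from \<open>r\<^sub>j\<close> exactly when \<open>e\<close> separates \<open>i\<close> from \<open>j\<close>
  (\<open>edge_splits_subset_iff\<close>). The rest of the argument speaks of partners only.

  Given a display, an edge \<open>e = {a, b}\<close> of \<open>T\<close> comes from an edge \<open>g = {u, v}\<close> of \<open>U\<close> between the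
  fibers of \<open>r\<^sub>a\<close> and \<open>r\<^sub>b\<close>, and \<open>g\<close> is a partner of \<open>e\<close>. Indeed, a path of \<open>T\<close> that avoids \<open>e\<close>
  lifts to a path of \<open>U\<close> that avoids \<open>g\<close>, because the fibers are connected without \<open>g\<close>. If
  conversely \<open>e\<close> separated \<open>i\<close> from \<open>j\<close> but \<open>g\<close> did not separate \<open>r\<^sub>i\<close> from \<open>r\<^sub>j\<close>, lifting both
  halves of the path from \<open>i\<close> to \<open>j\<close> would link \<open>u\<close> to \<open>v\<close> without \<open>g\<close>, although \<open>g\<close> is a bridge.

  Given partners, remove all of them from \<open>U\<close>. The fibers are the components of what remains, and
  the main point is that each of them contains exactly one \<open>r\<^sub>i\<close>. Distinct \<open>i\<close> and \<open>j\<close> are separated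
  by an edge of \<open>T\<close>, hence \<open>r\<^sub>i\<close> and \<open>r\<^sub>j\<close> by its partner. That no component is missed could be seen
  by counting; instead, \<open>tree_linked_minus\<close> (in a tree, two vertices separated by no single edge of
  a set are not separated by the whole set) locates the partner of \<open>e = {a, b}\<close>: no other partner
  separates \<open>r\<^sub>a\<close> from \<open>r\<^sub>b\<close>, so the two ends of the partner of \<open>e\<close> lie in the components of \<open>r\<^sub>a\<close>
  and \<open>r\<^sub>b\<close>. A walk in \<open>U\<close> that starts at some \<open>r\<^sub>k\<close> therefore never leaves the components that
  contain a survivor, and the same fact shows that contracting the components gives \<open>T\<close>.\<close>

section \<open>Linked vertices\<close>

abbreviation linked :: "'a set set \<Rightarrow> 'a \<Rightarrow> 'a \<Rightarrow> bool" where
  "linked E u v \<equiv> (u, v) \<in> (adj E)\<^sup>*"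

lemma linked_edge: "{u, v} \<in> E \<Longrightarrow> linked E u v"
  by (auto simp: adj_def)

lemma linked_sym: "linked E u v \<Longrightarrow> linked E v u"
proof -
  have "sym (adj E)"
    by (auto simp: sym_def adj_def insert_commute)
  then show "linked E u v \<Longrightarrow> linked E v u"
    by (meson sym_rtrancl symD)
qed

lemma linked_trans: "linked E u v \<Longrightarrow> linked E v w \<Longrightarrow> linked E u w"
  by (rule rtrancl_trans)

lemma linked_mono: "linked E u v \<Longrightarrow> E \<subseteq> F \<Longrightarrow> linked F u v"
proof -
  assume "linked E u v" "E \<subseteq> F"
  moreover from this have "adj E \<subseteq> adj F"
    by (auto simp: adj_def)
  ultimately show ?thesis
    using rtrancl_mono by blast
qed

lemma linked_no_edges: "linked {} u v \<Longrightarrow> u = v"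
  by (simp add: adj_def)

lemma linked_in_vertices:
  assumes "linked E u v" "simple_graph V E" "u \<in> V"
  shows "v \<in> V"
  using assms by (induction rule: rtrancl_induct) (auto simp: adj_def simple_graph_def)

lemma components_iff: "A \<in> components V E \<longleftrightarrow> (\<exists>x\<in>V. A = {y. linked E x y})"
  by (auto simp: components_def quotient_def Image_singleton)

text \<open>Every vertex on a path from \<open>u\<close> is itself linked to \<open>u\<close>; this makes the fibers of the
  constructed retraction induce connected subgraphs.\<close>

lemma linked_induced:
  assumes "linked F u v"
  shows "linked (induced_edges F {w. linked F u w}) u v"
  using assms
proof (induction rule: rtrancl_induct)
  case (step y z)
  have "linked F u z"
    using step.hyps by (rule rtrancl.rtrancl_into_rtrancl)
  then have "{y, z} \<in> induced_edges F {w. linked F u w}"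
    using step.hyps by (auto simp: adj_def induced_edges_def)
  then show ?case
    using step.IH linked_edge linked_trans by metis
qed simp

text \<open>A walk either avoids \<open>{s, t}\<close>, or one can cut it at the first and last visit to an end of
  this edge. The second visit may be to the same end as the first, but then the two outer pieces
  already form a walk that avoids the edge, so only three alternatives are left.\<close>

lemma linked_remove_edge:
  fixes s t :: 'a
  assumes "linked F u v"
  defines "H \<equiv> F - {{s, t}}"
  shows "linked H u v \<or> linked H u s \<and> linked H t v \<or> linked H u t \<and> linked H s v"
  using assms(1)
proof (induction rule: rtrancl_induct)
  case (step y z)
  show ?case
  proof (cases "{y, z} = {s, t}")
    case True
    then have "y = s \<and> z = t \<or> y = t \<and> z = s"
      by (auto simp: doubleton_eq_iff)
    then show ?thesis
      using step.IH by auto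
  next
    case False
    then have "linked H y z"
      using step.hyps by (intro linked_edge) (simp add: adj_def H_def)
    then show ?thesis
      using step.IH linked_trans by metis
  qed
qed simp

text \<open>Cycles are lists of distinct vertices, so relating reachability to cycles needs paths
  without repetitions: when the next vertex occurred before, the path is cut back to it.\<close>

lemma linked_distinct_path:
  assumes "linked E u v"
  shows "\<exists>vs. vs \<noteq> [] \<and> hd vs = u \<and> last vs = v \<and> distinct vs \<and>
    (\<forall>i. Suc i < length vs \<longrightarrow> {vs ! i, vs ! Suc i} \<in> E)"
  using assms
proof (induction rule: rtrancl_induct)
  case base
  show ?case
    by (rule exI[of _ "[u]"]) simp
next
  case (step y z)
  then obtain vs where vs: "vs \<noteq> []" "hd vs = u" "last vs = y" "distinct vs"
    "\<And>i. Suc i < length vs \<Longrightarrow> {vs ! i, vs ! Suc i} \<in> E"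
    by blast
  show ?case
  proof (cases "z \<in> set vs")
    case True
    then obtain k where k: "k < length vs" "vs ! k = z"
      by (auto simp: in_set_conv_nth)
    let ?ws = "take (Suc k) vs"
    have "last ?ws = z"
      using k by (simp add: take_Suc_conv_app_nth)
    moreover have "?ws \<noteq> []" "hd ?ws = u" "distinct ?ws"
      using vs by auto
    moreover have "\<forall>i. Suc i < length ?ws \<longrightarrow> {?ws ! i, ?ws ! Suc i} \<in> E"
      using vs(5) by auto
    ultimately show ?thesis
      by blast
  next
    case False
    let ?ws = "vs @ [z]"
    have "{?ws ! i, ?ws ! Suc i} \<in> E" if "Suc i < length ?ws" for i
    proof (cases "Suc i < length vs")
      case True
      then show ?thesis
        using vs(5) by (simp add: nth_append)
    next
      case False
      then have i: "i = length vs - 1" "Suc i = length vs"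
        using that by auto
      then have "?ws ! i = y" "?ws ! Suc i = z"
        using vs(1,3) by (auto simp: nth_append last_conv_nth)
      then show ?thesis
        using step.hyps by (simp add: adj_def)
    qed
    moreover have "?ws \<noteq> []" "hd ?ws = u" "last ?ws = z" "distinct ?ws"
      using vs False by auto
    ultimately show ?thesis
      by blast
  qed
qed

section \<open>Removing edges from a tree\<close>

lemma tree_linked: "is_tree V E \<Longrightarrow> u \<in> V \<Longrightarrow> v \<in> V \<Longrightarrow> linked E u v"
  by (simp add: is_tree_def connected_graph_def)

lemma tree_edgeE:
  assumes "is_tree V E" "e \<in> E"
  obtains a b where "e = {a, b}" "a \<noteq> b" "a \<in> V" "b \<in> V"
proof -
  have "card e = 2" "e \<subseteq> V"
    using assms by (auto simp: is_tree_def simple_graph_def)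
  then show thesis
    using that by (auto simp: card_2_iff)
qed

lemma tree_finite_edges: "is_tree V E \<Longrightarrow> finite E"
  by (rule finite_subset[of _ "Pow V"]) (auto simp: is_tree_def simple_graph_def)

lemma tree_linked_in_vertices:
  "is_tree V E \<Longrightarrow> linked F u v \<Longrightarrow> F \<subseteq> E \<Longrightarrow> u \<in> V \<Longrightarrow> v \<in> V"
  using linked_in_vertices linked_mono is_tree_def by metis

text \<open>A path from \<open>u\<close> to \<open>v\<close> without repetitions that avoids the edge \<open>{u, v}\<close> has at least three
  vertices, and the edge closes it to a cycle.\<close>

lemma tree_bridge:
  assumes tree: "is_tree V E" and edge: "{u, v} \<in> E"
  shows "\<not> linked (E - {{u, v}}) u v"
proof
  assume "linked (E - {{u, v}}) u v"
  then obtain vs where vs: "vs \<noteq> []" "hd vs = u" "last vs = v" "distinct vs"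
    "\<And>i. Suc i < length vs \<Longrightarrow> {vs ! i, vs ! Suc i} \<in> E - {{u, v}}"
    using linked_distinct_path by metis
  have "u \<noteq> v"
    using tree_edgeE[OF tree edge] by (metis doubleton_eq_iff)
  have u: "vs ! 0 = u" and v: "vs ! (length vs - 1) = v"
    using vs(1-3) by (simp_all add: hd_conv_nth last_conv_nth)
  have "length vs \<noteq> 0" "length vs \<noteq> 1"
    using u v vs(1) \<open>u \<noteq> v\<close> by auto
  moreover have "length vs \<noteq> 2"
    using u v vs(5)[of 0] by auto
  ultimately have "3 \<le> length vs"
    by linarith
  moreover have "{vs ! i, vs ! (Suc i mod length vs)} \<in> E" if "i < length vs" for i
  proof (cases "Suc i < length vs")
    case True
    then show ?thesis
      using vs(5) by simp
  next
    \<comment> \<open>The index wraps around: this is the closing edge.\<close>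
    case False
    then have "i = length vs - 1" "Suc i = length vs"
      using that by auto
    then show ?thesis
      using u v edge by (simp add: insert_commute)
  qed
  ultimately have "is_cycle E vs"
    using vs(4) by (simp add: is_cycle_def)
  then show False
    using tree by (auto simp: is_tree_def)
qed

text \<open>Removing \<open>e\<close> leaves only two components, so two vertices outside \<open>A\<close> are linked to each
  other: both are linked to the same end of \<open>e\<close>, namely the one that is not in \<open>A\<close>. This is why
  either member of a split determines the relation of being on the same side.\<close>

lemma tree_linked_iff_same_side:
  assumes tree: "is_tree V E" and e: "e \<in> E" and A: "A \<in> components V (E - {e})"
    and ij: "i \<in> V" "j \<in> V"
  shows "linked (E - {e}) i j \<longleftrightarrow> (i \<in> A \<longleftrightarrow> j \<in> A)"
proof -
  let ?H = "E - {e}"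
  obtain x where x: "x \<in> V" "A = {y. linked ?H x y}"
    using A unfolding components_iff by metis
  obtain s t where st: "e = {s, t}" "s \<in> V" "t \<in> V"
    using tree_edgeE[OF tree e] by metis
  have bridge: "\<not> linked ?H s t"
    using tree_bridge[OF tree, of s t] e st(1) by simp
  have far: "linked ?H x s \<and> linked ?H t y \<or> linked ?H x t \<and> linked ?H s y"
    if "y \<in> V" "y \<notin> A" for y
    using linked_remove_edge[OF tree_linked[OF tree x(1) that(1)], of s t] that(2) x(2) st(1)
    by simp
  have "linked ?H i j" if "i \<notin> A" "j \<notin> A"
    using far[OF ij(1) that(1)] far[OF ij(2) that(2)] bridge linked_sym linked_trans by metis
  moreover have "linked ?H i j" if "i \<in> A" "j \<in> A"
    using that x(2) linked_sym linked_trans by (metis mem_Collect_eq)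
  moreover have "i \<in> A \<longleftrightarrow> j \<in> A" if "linked ?H i j"
    using that x(2) linked_sym linked_trans by (metis mem_Collect_eq)
  ultimately show ?thesis
    by blast
qed

text \<open>The path between two vertices of a tree is unique, so if every edge of \<open>G\<close> can be avoided
  separately then all of them can be avoided at once. The induction removes one edge \<open>g\<close> more. If
  this disconnected \<open>u\<close> from \<open>v\<close>, they would be linked to different ends of \<open>g\<close>; as they are also
  linked to each other without \<open>g\<close>, so would be the ends of \<open>g\<close>, which is a bridge.\<close>

lemma tree_linked_minus:
  assumes tree: "is_tree V E" and "finite G" "linked E u v"
    and "\<And>g. g \<in> G \<Longrightarrow> linked (E - {g}) u v"
  shows "linked (E - G) u v"
  using assms(2-)
proof (induction G rule: finite_induct)
  case (insert g G)
  have IH: "linked (E - G) u v"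
    using insert by simp
  have eq: "E - insert g G = E - G - {g}"
    by blast
  show ?case
  proof (cases "g \<in> E")
    case True
    then obtain s t where g: "g = {s, t}"
      using tree_edgeE[OF tree] by metis
    have mono: "linked (E - {g}) x y" if "linked (E - G - {g}) x y" for x y
      using that by (rule linked_mono) blast
    have uv: "linked (E - {g}) u v"
      using insert by simp
    have "linked (E - {g}) s t"
      if "linked (E - {g}) u s" "linked (E - {g}) t v"
      using linked_trans[OF linked_trans[OF linked_sym[OF that(1)] uv] linked_sym[OF that(2)]] .
    moreover have "linked (E - {g}) s t"
      if "linked (E - {g}) u t" "linked (E - {g}) s v"
      using linked_trans[OF that(2) linked_trans[OF linked_sym[OF uv] that(1)]] .
    moreover have "\<not> linked (E - {g}) s t"
      using tree_bridge[OF tree, of s t] True g by simp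
    ultimately show ?thesis
      using linked_remove_edge[OF IH, of s t, folded g] mono unfolding eq by blast
  next
    case False
    then have "E - insert g G = E - G"
      by blast
    then show ?thesis
      using IH by simp
  qed
qed simp

text \<open>Otherwise \<open>u\<close> and \<open>v\<close> would stay linked after all edges are removed.\<close>

lemma tree_separating_edge:
  assumes tree: "is_tree V E" and "u \<in> V" "v \<in> V" "u \<noteq> v"
  shows "\<exists>e\<in>E. \<not> linked (E - {e}) u v"
proof (rule ccontr)
  assume "\<not> ?thesis"
  then have "linked (E - {e}) u v" if "e \<in> E" for e
    using that by simp
  then have "linked (E - E) u v"
    by (rule tree_linked_minus[OF tree tree_finite_edges[OF tree] tree_linked[OF tree assms(2,3)]])
  then show False
    using linked_no_edges assms(4) unfolding Diff_cancel by metis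
qed

lemma tree_induced_subgraph:
  assumes tree: "is_tree V E" and "S \<subseteq> V" "connected_graph S (induced_edges E S)"
  shows "is_tree S (induced_edges E S)"
proof -
  have "is_cycle E vs" if "is_cycle (induced_edges E S) vs" for vs
    using that by (auto simp: is_cycle_def induced_edges_def)
  then show ?thesis
    using assms finite_subset
    by (auto simp: is_tree_def simple_graph_def induced_edges_def)
qed

section \<open>Inclusion of splits\<close>

lemma bij_betw_nth_elem:
  assumes "finite R" "card R = n"
  shows "bij_betw (nth_elem R) {1..n} R"
proof -
  let ?xs = "sorted_list_of_set R"
  have "bij_betw ((!) ?xs) {..<n} R"
    using assms by (intro bij_betw_nth) auto
  moreover have "bij_betw (\<lambda>i. i - 1) {1..n} {..<n}"
    by (rule bij_betwI[where g = Suc]) auto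
  ultimately have "bij_betw ((!) ?xs \<circ> (\<lambda>i. i - 1)) {1..n} R"
    by (rule bij_betw_trans[rotated])
  then show ?thesis
    by (simp add: nth_elem_def[abs_def] comp_def)
qed

text \<open>Replaces unordered bipartitions by the relation of lying on the same side. From right to
  left, the parts of a split of \<open>T\<close> are nonempty because an edge has an end on either side; so the
  matching bipartition of survivor indices is proper, as survivor splits are required to be.\<close>

lemma edge_splits_subset_iff:
  assumes T: "is_tree {1..n} T" and U: "is_tree {1..m} U"
    and R: "\<And>i. i \<in> {1..n} \<Longrightarrow> nth_elem R i \<in> {1..m}"
  shows "edge_splits n T \<subseteq> survivor_splits n m U R \<longleftrightarrow>
    (\<forall>e\<in>T. \<exists>g\<in>U. \<forall>i\<in>{1..n}. \<forall>j\<in>{1..n}.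
      linked (T - {e}) i j \<longleftrightarrow> linked (U - {g}) (nth_elem R i) (nth_elem R j))"
    (is "?L \<longleftrightarrow> (\<forall>e\<in>T. \<exists>g\<in>U. ?same e g)")
proof
  assume L: ?L
  show "\<forall>e\<in>T. \<exists>g\<in>U. ?same e g"
  proof
    fix e assume e: "e \<in> T"
    obtain a where "a \<in> {1..n}"
      using tree_edgeE[OF T e] by metis
    then obtain A where A: "A \<in> components {1..n} (T - {e})"
      unfolding components_iff by metis
    then have "{A, {1..n} - A} \<in> survivor_splits n m U R"
      using L e unfolding edge_splits_def by blast
    then obtain I g C where g: "g \<in> U" and C: "C \<in> components {1..m} (U - {g})"
      and I: "I = {i \<in> {1..n}. nth_elem R i \<in> C}" and eq: "{A, {1..n} - A} = {I, {1..n} - I}"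
      unfolding survivor_splits_def by blast
    have "(i \<in> A \<longleftrightarrow> j \<in> A) \<longleftrightarrow> (i \<in> I \<longleftrightarrow> j \<in> I)" if "i \<in> {1..n}" "j \<in> {1..n}" for i j
    proof -
      have "A = I \<or> A = {1..n} - I"
        using eq by (auto simp: doubleton_eq_iff)
      then show ?thesis
        using that by blast
    qed
    then have "?same e g"
      using tree_linked_iff_same_side[OF T e A] tree_linked_iff_same_side[OF U g C] R I by auto
    then show "\<exists>g\<in>U. ?same e g"
      using g by blast
  qed
next
  assume same: "\<forall>e\<in>T. \<exists>g\<in>U. ?same e g"
  show ?L
  proof
    fix S assume "S \<in> edge_splits n T"
    then obtain A e where S: "S = {A, {1..n} - A}" and e: "e \<in> T"
      and A: "A \<in> components {1..n} (T - {e})"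
      unfolding edge_splits_def by blast
    obtain x where x: "x \<in> {1..n}" "A = {y. linked (T - {e}) x y}"
      using A unfolding components_iff by metis
    obtain g where g: "g \<in> U" "?same e g"
      using same e by blast
    define C where "C = {y. linked (U - {g}) (nth_elem R x) y}"
    have C: "C \<in> components {1..m} (U - {g})"
      using R[OF x(1)] unfolding components_iff C_def by blast
    have "A \<subseteq> {1..n}"
      using tree_linked_in_vertices[OF T _ _ x(1), where F = "T - {e}"] x(2) by blast
    then have I: "A = {i \<in> {1..n}. nth_elem R i \<in> C}"
      using g(2) x by (auto simp: C_def)
    obtain a b where ab: "e = {a, b}" "a \<in> {1..n}" "b \<in> {1..n}"
      using tree_edgeE[OF T e] by metis
    have "\<not> linked (T - {e}) a b"
      using tree_bridge[OF T] e ab(1) by simp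
    then have "{1..n} - A \<noteq> {}"
      using tree_linked_iff_same_side[OF T e A ab(2,3)] ab by blast
    moreover have "A \<noteq> {}"
      using x by auto
    ultimately show "S \<in> survivor_splits n m U R"
      unfolding survivor_splits_def using S g(1) C I by blast
  qed
qed

section \<open>From a display to an inclusion of splits\<close>

text \<open>A partner of \<open>e = {a, b}\<close> is any edge of \<open>U\<close> between the fibers of \<open>r\<^sub>a\<close> and \<open>r\<^sub>b\<close>; one
  exists because \<open>e\<close> is an edge of the quotient.\<close>

lemma display_same_sides:
  assumes T: "is_tree {1..n} T" and U: "is_tree {1..m} U"
    and D: "is_display n T m U (R, q)" and e: "e \<in> T"
  shows "\<exists>g\<in>U. \<forall>i\<in>{1..n}. \<forall>j\<in>{1..n}.
    linked (T - {e}) i j \<longleftrightarrow> linked (U - {g}) (nth_elem R i) (nth_elem R j)"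
proof -
  let ?r = "nth_elem R" and ?F = "\<lambda>i. fiber m q (nth_elem R i)"
  have RV: "R \<subseteq> {1..m}" and cR: "card R = n" and q: "\<forall>r\<in>R. q r = r"
    and fib: "\<And>i. i \<in> {1..n} \<Longrightarrow> is_tree (?F i) (induced_edges U (?F i))"
    and quot: "quotient_edges n m U R q = T"
    using D by (auto simp: is_display_def)
  have "bij_betw ?r {1..n} R"
    using bij_betw_nth_elem[OF finite_subset[OF RV] cR] by simp
  then have inj: "inj_on ?r {1..n}" and rR: "\<And>i. i \<in> {1..n} \<Longrightarrow> ?r i \<in> R"
    by (auto simp: bij_betw_def)
  have rF: "?r i \<in> ?F i" if "i \<in> {1..n}" for i
    using rR[OF that] q RV by (auto simp: fiber_def)
  have F_disj: "i = j" if "w \<in> ?F i" "w \<in> ?F j" "i \<in> {1..n}" "j \<in> {1..n}" for i j w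
  proof -
    have "?r i = ?r j"
      using that(1,2) by (simp add: fiber_def)
    then show ?thesis
      using inj_onD[OF inj] that(3,4) by blast
  qed
  have lift: "\<exists>i j u v. {a, b} = {i, j} \<and> i \<in> {1..n} \<and> j \<in> {1..n} \<and> i \<noteq> j \<and>
      u \<in> ?F i \<and> v \<in> ?F j \<and> {u, v} \<in> U" if "{a, b} \<in> T" for a b
    using that unfolding quot[symmetric] quotient_edges_def by blast
  obtain c d where "e = {c, d}"
    using tree_edgeE[OF T e] by metis
  then obtain a b u v where ab: "e = {a, b}" "a \<in> {1..n}" "b \<in> {1..n}" "a \<noteq> b"
    and uv: "u \<in> ?F a" "v \<in> ?F b" "{u, v} \<in> U"
    using lift[of c d] e by metis
  let ?g = "{u, v}"
  let ?H = "U - {?g}"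
  have in_fiber: "linked ?H x y" if "x \<in> ?F i" "y \<in> ?F i" "i \<in> {1..n}" for x y i
  proof -
    have "\<not> ?g \<subseteq> ?F i"
      using F_disj[OF uv(1) _ ab(2) that(3)] F_disj[OF uv(2) _ ab(3) that(3)] ab(4) by auto
    then have "induced_edges U (?F i) \<subseteq> ?H"
      by (auto simp: induced_edges_def)
    then show ?thesis
      by (rule linked_mono[OF tree_linked[OF fib[OF that(3)] that(1,2)]])
  qed
  \<comment> \<open>A step of a walk in \<open>T\<close> lifts to an edge of \<open>U\<close> between two fibers, joined to the survivors
      inside the fibers; it is not \<open>{u, v}\<close>, which lies over \<open>e\<close>.\<close>
  have path: "linked ?H (?r i) (?r j)" if "linked (T - {e}) i j" for i j
    using that
  proof (induction rule: rtrancl_induct)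
    case (step y z)
    then have yz: "{y, z} \<in> T" "{y, z} \<noteq> {a, b}"
      using ab(1) by (auto simp: adj_def)
    then obtain y' z' s t where st: "{y, z} = {y', z'}" "y' \<in> {1..n}" "z' \<in> {1..n}"
      "s \<in> ?F y'" "t \<in> ?F z'" "{s, t} \<in> U"
      using lift by metis
    have "{s, t} \<noteq> ?g"
    proof
      assume "{s, t} = ?g"
      then have "s = u \<and> t = v \<or> s = v \<and> t = u"
        by (auto simp: doubleton_eq_iff)
      then have "y' = a \<and> z' = b \<or> y' = b \<and> z' = a"
        using F_disj[OF st(4) _ st(2)] F_disj[OF st(5) _ st(3)] uv ab(2,3) by blast
      then have "{y', z'} = {a, b}"
        by auto
      then show False
        using yz st by simp
    qed
    then have "linked ?H s t"
      using st by (intro linked_edge) simp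
    then have "linked ?H (?r y') (?r z')"
      using in_fiber[OF rF[OF st(2)] st(4,2)] in_fiber[OF st(5) rF[OF st(3)] st(3)] linked_trans
      by metis
    moreover have "y = y' \<and> z = z' \<or> y = z' \<and> z = y'"
      using st(1) by (simp add: doubleton_eq_iff)
    ultimately have "linked ?H (?r y) (?r z)"
      using linked_sym by metis
    with step.IH show ?case
      by (rule linked_trans)
  qed simp
  have "linked (T - {e}) i j" if "i \<in> {1..n}" "j \<in> {1..n}" "linked ?H (?r i) (?r j)" for i j
  proof (rule ccontr)
    assume "\<not> ?thesis"
    then have "linked (T - {e}) i a \<and> linked (T - {e}) b j \<or>
        linked (T - {e}) i b \<and> linked (T - {e}) a j"
      using linked_remove_edge[OF tree_linked[OF T that(1,2)], of a b] ab(1) by auto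
    then have "linked ?H (?r i) (?r a) \<and> linked ?H (?r b) (?r j) \<or>
        linked ?H (?r i) (?r b) \<and> linked ?H (?r a) (?r j)"
      using path by blast
    then have "linked ?H (?r a) (?r b)"
      using that(3) linked_sym linked_trans by metis
    then have "linked ?H u v"
      using in_fiber[OF uv(1) rF[OF ab(2)] ab(2)] in_fiber[OF rF[OF ab(3)] uv(2) ab(3)]
        linked_trans by metis
    then show False
      using tree_bridge[OF U uv(3)] by simp
  qed
  then show ?thesis
    using path uv(3) by blast
qed

section \<open>From an inclusion of splits to a display\<close>

text \<open>The retraction sends a vertex to the survivor in its component after all the partners have
  been removed from \<open>U\<close>.\<close>

lemma display_of_same_sides:
  assumes T: "is_tree {1..n} T" and U: "is_tree {1..m} U"
    and RV: "R \<subseteq> {1..m}" and cR: "card R = n"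
    and same: "\<forall>e\<in>T. \<exists>g\<in>U. \<forall>i\<in>{1..n}. \<forall>j\<in>{1..n}.
      linked (T - {e}) i j \<longleftrightarrow> linked (U - {g}) (nth_elem R i) (nth_elem R j)"
  shows "displayed_in n T m U"
proof -
  let ?r = "nth_elem R"
  have bij: "bij_betw ?r {1..n} R"
    using bij_betw_nth_elem[OF finite_subset[OF RV] cR] by simp
  then have rR: "\<And>i. i \<in> {1..n} \<Longrightarrow> ?r i \<in> R" and R_img: "R = ?r ` {1..n}"
    by (auto simp: bij_betw_def)
  have rV: "?r i \<in> {1..m}" if "i \<in> {1..n}" for i
    using rR[OF that] RV by auto
  obtain \<gamma> where \<gamma>U: "\<And>e. e \<in> T \<Longrightarrow> \<gamma> e \<in> U"
    and \<gamma>: "\<And>e i j. e \<in> T \<Longrightarrow> i \<in> {1..n} \<Longrightarrow> j \<in> {1..n} \<Longrightarrow>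
      linked (T - {e}) i j \<longleftrightarrow> linked (U - {\<gamma> e}) (?r i) (?r j)"
    using bchoice[OF same[unfolded Bex_def]] by metis
  define F where "F = U - \<gamma> ` T"
  have finG: "finite (\<gamma> ` T)"
    using tree_finite_edges[OF T] by simp
  have apart: "i = j" if l: "linked F (?r i) (?r j)" and ij: "i \<in> {1..n}" "j \<in> {1..n}" for i j
  proof (rule ccontr)
    assume "i \<noteq> j"
    then obtain e where e: "e \<in> T" "\<not> linked (T - {e}) i j"
      using tree_separating_edge[OF T ij] by blast
    have "linked (U - {\<gamma> e}) (?r i) (?r j)"
      using l by (rule linked_mono) (use e in \<open>auto simp: F_def\<close>)
    then show False
      using e(2) \<gamma>[OF e(1) ij] by simp
  qed
  \<comment> \<open>A partner of another edge \<open>f\<close> does not separate \<open>r\<^sub>a\<close> from \<open>r\<^sub>b\<close>, since \<open>e\<close> itself links \<open>a\<close> to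
      \<open>b\<close> in \<open>T\<close> without \<open>f\<close>. Hence \<open>r\<^sub>a\<close> and \<open>r\<^sub>b\<close> are linked when only \<open>\<gamma> e\<close> is put back,
      and this path must run through \<open>\<gamma> e\<close>.\<close>
  have ends: "linked F (?r a) x \<and> linked F (?r b) y \<or> linked F (?r a) y \<and> linked F (?r b) x"
    if e: "e \<in> T" "e = {a, b}" and g: "\<gamma> e = {x, y}" for e a b x y
  proof -
    have ab: "a \<in> {1..n}" "b \<in> {1..n}"
      using e T by (auto simp: is_tree_def simple_graph_def)
    have "\<not> linked (T - {e}) a b"
      using tree_bridge[OF T] e by simp
    then have cut: "\<not> linked (U - {\<gamma> e}) (?r a) (?r b)"
      using \<gamma>[OF e(1) ab] by simp
    have "linked (U - (\<gamma> ` T - {\<gamma> e})) (?r a) (?r b)"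
    proof (rule tree_linked_minus[OF U])
      fix g' assume "g' \<in> \<gamma> ` T - {\<gamma> e}"
      then obtain f where f: "f \<in> T" "g' = \<gamma> f" "f \<noteq> e"
        by auto
      then have "linked (T - {f}) a b"
        using e by (intro linked_edge) simp
      then show "linked (U - {g'}) (?r a) (?r b)"
        using \<gamma>[OF f(1) ab] f(2) by simp
    qed (simp_all add: finG tree_linked[OF U rV[OF ab(1)] rV[OF ab(2)]])
    moreover have "U - (\<gamma> ` T - {\<gamma> e}) - {{x, y}} = F"
      using g e(1) by (auto simp: F_def)
    moreover have "\<not> linked F (?r a) (?r b)"
    proof
      assume "linked F (?r a) (?r b)"
      then have "linked (U - {\<gamma> e}) (?r a) (?r b)"
        by (rule linked_mono) (use e(1) in \<open>auto simp: F_def\<close>)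
      then show False
        using cut by simp
    qed
    ultimately show ?thesis
      using linked_remove_edge[where F = "U - (\<gamma> ` T - {\<gamma> e})" and u = "?r a" and v = "?r b"
          and s = x and t = y] linked_sym by metis
  qed
  \<comment> \<open>Along a walk in \<open>U\<close> from some survivor: a step that is not a partner stays in the component,
      and both ends of a partner are in components of survivors.\<close>
  have cover: "\<exists>i\<in>{1..n}. linked F (?r i) x" if x: "x \<in> {1..m}" for x
  proof -
    obtain k where k: "k \<in> {1..n}"
      using T by (auto simp: is_tree_def connected_graph_def)
    have "linked U (?r k) x"
      using tree_linked[OF U rV[OF k] x] .
    then show ?thesis
    proof (induction rule: rtrancl_induct)
      case base
      then show ?case
        using k by blast
    next
      case (step y z)
      then have yz: "{y, z} \<in> U"
        by (simp add: adj_def)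
      show ?case
      proof (cases "{y, z} \<in> \<gamma> ` T")
        case True
        then obtain e where e: "e \<in> T" "\<gamma> e = {y, z}"
          by auto
        then obtain a b where ab: "e = {a, b}" "a \<in> {1..n}" "b \<in> {1..n}"
          using tree_edgeE[OF T] by metis
        then show ?thesis
          using ends[OF e(1) ab(1) e(2)] by auto
      next
        case False
        then have "linked F y z"
          using yz by (intro linked_edge) (simp add: F_def)
        then show ?thesis
          using step.IH linked_trans by metis
      qed
    qed
  qed
  define q where
    "q = restrict (\<lambda>x. ?r (SOME i. i \<in> {1..n} \<and> linked F (?r i) x)) {1..m}"
  have q_eq: "q x = ?r i" if "linked F (?r i) x" "i \<in> {1..n}" "x \<in> {1..m}" for i x
  proof -
    let ?k = "SOME i. i \<in> {1..n} \<and> linked F (?r i) x"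
    have k: "?k \<in> {1..n} \<and> linked F (?r ?k) x"
      by (rule someI[of "\<lambda>i. i \<in> {1..n} \<and> linked F (?r i) x" i]) (use that in simp)
    have "?k = i"
      by (rule apart[OF linked_trans[OF _ linked_sym[OF that(1)]] _ that(2)]) (use k in auto)
    then show ?thesis
      using that(3) by (simp add: q_def)
  qed
  have fiber_iff: "x \<in> fiber m q (?r i) \<longleftrightarrow> linked F (?r i) x" if i: "i \<in> {1..n}" for i x
  proof
    assume "x \<in> fiber m q (?r i)"
    then have x: "x \<in> {1..m}" "q x = ?r i"
      by (auto simp: fiber_def)
    then obtain j where j: "j \<in> {1..n}" "linked F (?r j) x"
      using cover by blast
    then have "?r j = ?r i"
      using q_eq x by simp
    then show "linked F (?r i) x"
      using j by simp
  next
    assume l: "linked F (?r i) x"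
    then have "x \<in> {1..m}"
      using tree_linked_in_vertices[OF U l _ rV[OF i]] by (auto simp: F_def)
    then show "x \<in> fiber m q (?r i)"
      using q_eq l i by (simp add: fiber_def)
  qed
  have fiber_tree: "is_tree (fiber m q (?r i)) (induced_edges U (fiber m q (?r i)))"
    if i: "i \<in> {1..n}" for i
  proof (rule tree_induced_subgraph[OF U])
    show "fiber m q (?r i) \<subseteq> {1..m}"
      by (auto simp: fiber_def)
    have fib: "fiber m q (?r i) = {x. linked F (?r i) x}"
      using fiber_iff[OF i] by (simp add: set_eq_iff)
    have "linked (induced_edges U (fiber m q (?r i))) (?r i) x"
      if "x \<in> fiber m q (?r i)" for x
    proof -
      have "linked F (?r i) x"
        using that fib by simp
      from linked_induced[OF this] show ?thesis
        unfolding fib by (rule linked_mono) (auto simp: induced_edges_def F_def)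
    qed
    moreover have "?r i \<in> fiber m q (?r i)"
      by (simp add: fib)
    ultimately show "connected_graph (fiber m q (?r i)) (induced_edges U (fiber m q (?r i)))"
      unfolding connected_graph_def using linked_sym linked_trans by (metis empty_iff)
  qed
  have "quotient_edges n m U R q = T"
  proof
    show "quotient_edges n m U R q \<subseteq> T"
    proof
      fix e assume "e \<in> quotient_edges n m U R q"
      then obtain i j u v where e: "e = {i, j}" and ij: "i \<in> {1..n}" "j \<in> {1..n}" "i \<noteq> j"
        and "u \<in> fiber m q (?r i)" "v \<in> fiber m q (?r j)" and uv: "{u, v} \<in> U"
        unfolding quotient_edges_def by blast
      then have l: "linked F (?r i) u" "linked F (?r j) v"
        using fiber_iff by auto
      have "{u, v} \<in> \<gamma> ` T"
      proof (rule ccontr)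
        assume "{u, v} \<notin> \<gamma> ` T"
        then have "linked F u v"
          using uv by (intro linked_edge) (simp add: F_def)
        then have "linked F (?r i) (?r j)"
          using linked_trans[OF linked_trans[OF l(1)] linked_sym[OF l(2)]] by simp
        then show False
          using apart ij by simp
      qed
      then obtain f where f: "f \<in> T" "\<gamma> f = {u, v}"
        by auto
      then obtain a b where ab: "f = {a, b}" "a \<in> {1..n}" "b \<in> {1..n}"
        using tree_edgeE[OF T] by metis
      have "k = i" if "linked F (?r k) u" "k \<in> {1..n}" for k
        using apart[OF linked_trans[OF that(1) linked_sym[OF l(1)]] that(2) ij(1)] .
      moreover have "k = j" if "linked F (?r k) v" "k \<in> {1..n}" for k
        using apart[OF linked_trans[OF that(1) linked_sym[OF l(2)]] that(2) ij(2)] .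
      ultimately have "i = a \<and> j = b \<or> i = b \<and> j = a"
        using ends[OF f(1) ab(1) f(2)] ab(2,3) by auto
      then show "e \<in> T"
        using f ab e by (auto simp: insert_commute)
    qed
    show "T \<subseteq> quotient_edges n m U R q"
    proof
      fix e assume e: "e \<in> T"
      obtain a b where ab: "e = {a, b}" "a \<noteq> b" "a \<in> {1..n}" "b \<in> {1..n}"
        using tree_edgeE[OF T e] by metis
      obtain x y where xy: "\<gamma> e = {x, y}"
        using tree_edgeE[OF U \<gamma>U[OF e]] by metis
      then have "{x, y} \<in> U" "{y, x} \<in> U"
        using \<gamma>U[OF e] by (auto simp: insert_commute)
      then have "\<exists>u\<in>fiber m q (?r a). \<exists>v\<in>fiber m q (?r b). {u, v} \<in> U"
        using ends[OF e ab(1) xy] fiber_iff[OF ab(3)] fiber_iff[OF ab(4)] by metis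
      then show "e \<in> quotient_edges n m U R q"
        unfolding quotient_edges_def using ab by blast
    qed
  qed
  moreover have "q \<in> {1..m} \<rightarrow>\<^sub>E R"
  proof (rule PiE_I)
    fix x assume x: "x \<in> {1..m}"
    then show "q x \<in> R"
      using cover q_eq rR by metis
  qed (auto simp: q_def)
  moreover have "\<forall>r\<in>R. q r = r"
  proof
    fix r assume "r \<in> R"
    then obtain i where i: "i \<in> {1..n}" "r = ?r i"
      using equalityD1[OF R_img] by blast
    then show "q r = r"
      using q_eq[OF rtrancl_refl i(1) rV[OF i(1)]] by simp
  qed
  ultimately have "is_display n T m U (R, q)"
    using RV cR fiber_tree by (simp add: is_display_def)
  then show ?thesis
    unfolding displayed_in_def by blast
qed

section \<open>Displays and splits\<close>

theorem theorem1p2: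
  fixes n m :: nat and T U :: "nat set set"
  assumes "T \<in> labeled_trees n" and "U \<in> labeled_trees m"
  shows "displayed_in n T m U \<longleftrightarrow>
    (\<exists>R. R \<subseteq> {1..m} \<and> card R = n \<and> edge_splits n T \<subseteq> survivor_splits n m U R)"
proof -
  have T: "is_tree {1..n} T" and U: "is_tree {1..m} U"
    using assms by (auto simp: labeled_trees_def)
  have r: "nth_elem R i \<in> {1..m}" if "R \<subseteq> {1..m}" "card R = n" "i \<in> {1..n}" for R i
    using bij_betwE[OF bij_betw_nth_elem[OF finite_subset[OF that(1)] that(2)]] that by blast
  show ?thesis
  proof
    assume "displayed_in n T m U"
    then obtain R q where D: "is_display n T m U (R, q)"
      by (auto simp: displayed_in_def)
    then have R: "R \<subseteq> {1..m}" "card R = n"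
      by (auto simp: is_display_def)
    then have "edge_splits n T \<subseteq> survivor_splits n m U R"
      using edge_splits_subset_iff[OF T U r[OF R]] display_same_sides[OF T U D] by blast
    then show "\<exists>R. R \<subseteq> {1..m} \<and> card R = n \<and> edge_splits n T \<subseteq> survivor_splits n m U R"
      using R by blast
  next
    assume "\<exists>R. R \<subseteq> {1..m} \<and> card R = n \<and> edge_splits n T \<subseteq> survivor_splits n m U R"
    then obtain R where R: "R \<subseteq> {1..m}" "card R = n"
      "edge_splits n T \<subseteq> survivor_splits n m U R"
      by blast
    then show "displayed_in n T m U"
      using edge_splits_subset_iff[OF T U r[OF R(1,2)]] display_of_same_sides[OF T U R(1,2)]
      by blast
  qed
qed

end
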